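(* Let $(c_n)_{n\ge0}$ be a sequence of nonzero numbers with $c_0=1$, let $\omega$ be an umbra with $\omega^n\simeq n!/c_n$, and let $\gamma,\alpha$ be umbrae. Let $n\ge k\ge0$ and let $m$ be an integer with $2k-n\ge m$. Then \[ {}_{\omega}(\gamma,\alpha)_{n,k}\simeq\frac{c_n}{c_k}\sum_{i=0}^{n-k}\frac{c_{k-m-i}}{c_{n-m-2i}}\,\frac{\big(-m.\mathfrak K_{-1.\alpha}\big)^{i}}{i!}\;{}_{\omega}(\gamma,\alpha)_{n-m-2i,\,k-m-i}. \] Classically, $\big(-m.\mathfrak K_{-1.\alpha}\big)^i\simeq i!\,[t^i]\Big(f_\alpha\big((t/f_\alpha(t))^{\langle-1\rangle}\big)\Big)^m$.
   Context: Classical umbral calculus: $R=\mathbb{C}[x]$, $A$ a saturated alphabet of umbrae, $E:R[A]\to R$ linear with $E[1]=1$ and $E[\alpha^i\beta^j\cdots]=E[\alpha^i]E[\beta^j]\cdots$ for distinct umbrae; $p\simeq q$ means $E[p]=E[q]$. $f_\alpha(t)=\sum_n E[\alpha^n]t^n/n!$; $g^{\langle-1\rangle}$ denotes compositional inverse of a series $g$ with $g(0)=0$, $g'(0)\neq0$. For an integer $x$ (possibly negative), $x.\alpha$ is an umbra with $(x.\alpha)^n\simeq n![t^n]f_\alpha(t)^x$; $-m.\mathfrak K$ means $(-m).\mathfrak K$. For umbrae $\sigma,\alpha$, $\mathfrak K_{\sigma,\alpha}$ is an umbra with $\mathfrak K_{\sigma,\alpha}^0=1$ and $\mathfrak K_{\sigma,\alpha}^n\simeq\sigma(\sigma+(-n).\alpha)^{n-1}$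 for $n\ge1$, with $(-n).\alpha$ uncorrelated with $\sigma$; $\mathfrak K_\sigma:=\mathfrak K_{\sigma,\sigma}$, so $\mathfrak K_{-1.\alpha}=\mathfrak K_{-1.\alpha,-1.\alpha}$. The $\omega$-Riordan array ${}_\omega(\gamma,\alpha)$ is the lower triangular matrix with entries ${}_\omega(\gamma,\alpha)_{n,k}=E\!\left[\frac{c_n}{c_k}\frac{(\gamma+k.\alpha)^{n-k}}{(n-k)!}\right]$ for $n\ge k\ge0$, where $\gamma$ and $k.\alpha$ are uncorrelated. *)

theory Defs
  imports
    "HOL-Library.Poly_Mapping"
    "HOL-Computational_Algebra.Computational_Algebra"
begin

text \<open>
  The alphabet is the type \<open>'u\<close>, the ground ring \<open>R\<close> is \<open>complex poly\<close>, and an element of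
  \<open>R[A]\<close> is a finitely supported map from monomials to \<open>R\<close>.
\<close>

type_synonym 'u umbral_poly = "('u \<Rightarrow>\<^sub>0 nat) \<Rightarrow>\<^sub>0 complex poly"

definition cst :: "complex poly \<Rightarrow> 'u umbral_poly" where
  "cst r = Poly_Mapping.single 0 r"

abbreviation num :: "complex \<Rightarrow> 'u umbral_poly" where
  "num z \<equiv> cst [:z:]"

definition umb :: "'u \<Rightarrow> 'u umbral_poly" where
  "umb \<alpha> = Poly_Mapping.single (Poly_Mapping.single \<alpha> 1) 1"

text \<open>
  Distinct umbrae are uncorrelated, by the factorization axiom.  Saturation: every sequence in \<open>R\<close>
  starting with 1 is the moment sequence of infinitely many umbrae, so that a representing umbra
  distinct from (hence uncorrelated with) any given one always exists.
\<close>

locale saturated_umbral_calculus =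
  fixes E :: "'u umbral_poly \<Rightarrow> complex poly"
  assumes E_add: "E (p + q) = E p + E q"
    and E_scale: "E (cst r * p) = r * E p"
    and E_one: "E 1 = 1"
    and E_uncorrelated: "finite S \<Longrightarrow> E (\<Prod>\<alpha>\<in>S. umb \<alpha> ^ e \<alpha>) = (\<Prod>\<alpha>\<in>S. E (umb \<alpha> ^ e \<alpha>))"
    and saturated: "a 0 = 1 \<Longrightarrow> infinite {\<alpha>. \<forall>n. E (umb \<alpha> ^ n) = a n}"

definition umbral_equiv ::
    "'u umbral_poly \<Rightarrow> ('u umbral_poly \<Rightarrow> complex poly) \<Rightarrow> 'u umbral_poly \<Rightarrow> bool"
    (\<open>(_ \<simeq>\<^bsub>_\<^esub> _)\<close> [51, 0, 51] 50) where
  "p \<simeq>\<^bsub>E\<^esub> q \<longleftrightarrow> E p = E q"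

definition gen_fun :: "('u umbral_poly \<Rightarrow> complex poly) \<Rightarrow> 'u \<Rightarrow> complex poly fps" where
  "gen_fun E \<alpha> = Abs_fps (\<lambda>n. smult (1 / fact n) (E (umb \<alpha> ^ n)))"

text \<open>
  Since \<open>complex poly\<close> is not a field, \<open>inverse\<close>, \<open>powi\<close> and \<open>fps_inv\<close> are not available for
  series over it.  The integer power below is only used for series with constant term 1, where
  \<open>fps_right_inverse f 1\<close> is the reciprocal of \<open>f\<close>.
\<close>

definition fps_zpow :: "'a::comm_ring_1 fps \<Rightarrow> int \<Rightarrow> 'a fps" where
  "fps_zpow f x = (if x \<ge> 0 then f ^ nat x else fps_right_inverse f 1 ^ nat (- x))"

definition fps_comp_inv :: "'a::comm_ring_1 fps \<Rightarrow> 'a fps" where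
  "fps_comp_inv g = (THE h. fps_nth h 0 = 0 \<and> g oo h = fps_X \<and> h oo g = fps_X)"

definition is_dot :: "('u umbral_poly \<Rightarrow> complex poly) \<Rightarrow> int \<Rightarrow> 'u \<Rightarrow> 'u \<Rightarrow> bool" where
  "is_dot E x \<alpha> \<delta> \<longleftrightarrow>
     (\<forall>n. umb \<delta> ^ n \<simeq>\<^bsub>E\<^esub> cst (smult (fact n) (fps_nth (fps_zpow (gen_fun E \<alpha>) x) n)))"

text \<open>A choice of the umbra \<open>x.\<alpha>\<close> uncorrelated with \<open>\<beta>\<close>.\<close>

definition dot_uncorr :: "('u umbral_poly \<Rightarrow> complex poly) \<Rightarrow> 'u \<Rightarrow> int \<Rightarrow> 'u \<Rightarrow> 'u" where
  "dot_uncorr E \<beta> x \<alpha> = (SOME \<delta>. \<delta> \<noteq> \<beta> \<and> is_dot E x \<alpha> \<delta>)"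

text \<open>\<open>\<kappa>\<close> is an umbra \<open>K\<^bsub>\<sigma>,\<alpha>\<^esub>\<close>; the condition on the zeroth power holds automatically.\<close>

definition is_K_umbra :: "('u umbral_poly \<Rightarrow> complex poly) \<Rightarrow> 'u \<Rightarrow> 'u \<Rightarrow> 'u \<Rightarrow> bool" where
  "is_K_umbra E \<sigma> \<alpha> \<kappa> \<longleftrightarrow>
     (\<forall>n\<ge>1. umb \<kappa> ^ n \<simeq>\<^bsub>E\<^esub>
        umb \<sigma> * (umb \<sigma> + umb (dot_uncorr E \<sigma> (- int n) \<alpha>)) ^ (n - 1))"

text \<open>The umbra \<open>\<omega>\<close> enters the array only through \<open>c\<close>, where \<open>\<omega>\<^sup>n \<simeq> n! / c n\<close>.\<close>

definition riordan ::
    "('u umbral_poly \<Rightarrow> complex poly) \<Rightarrow> (nat \<Rightarrow> complex) \<Rightarrow> 'u \<Rightarrow> 'u \<Rightarrow> nat \<Rightarrow> nat \<Rightarrow> complex poly"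
  where
  "riordan E c \<gamma> \<alpha> n k =
     (if k \<le> n
      then E (num (c n / c k) *
              ((umb \<gamma> + umb (dot_uncorr E \<gamma> (int k) \<alpha>)) ^ (n - k) * num (1 / fact (n - k))))
      else 0)"

end

theory Submission
  imports Defs
begin

text \<open>
  Let \<open>f\<close> be the generating function of \<open>\<alpha>\<close> and \<open>s = 1/f\<close>, \<open>g = (t s)\<^sup>\<langle>\<^sup>-\<^sup>1\<^sup>\<rangle>\<close>.  The moments of \<open>K\<close>
  are \<open>(n-1)! [t\<^sup>n\<^sup>-\<^sup>1] s' s\<^sup>-\<^sup>n\<close>, so Lagrange inversion identifies its generating function as
  \<open>s(g) = 1 / f(g)\<close>; hence the generating function of \<open>(-m).K\<close> is \<open>f(g)\<^sup>m = \<Sum> a\<^sub>i t\<^sup>i\<close>.  Substituting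
  \<open>t s\<close> for \<open>t\<close> gives \<open>f\<^sup>m = \<Sum> a\<^sub>i (t/f)\<^sup>i\<close>, and comparing coefficients of \<open>t\<^sup>n\<^sup>-\<^sup>k\<close> in
  \<open>f\<^sub>\<gamma> f\<^sup>k = f\<^sub>\<gamma> f\<^sup>k\<^sup>-\<^sup>m \<Sum> a\<^sub>i (t/f)\<^sup>i\<close> yields the recurrence.
\<close>

subsection \<open>Formal power series over integral domains\<close>

unbundle fps_syntax

text \<open>Since \<open>b\<close> has no constant term, \<open>b ^ i\<close> contributes nothing
  below degree \<open>i\<close>. Hence every inner sum may run up to the common bound
  \<open>n\<close>, and the summations can be swapped.\<close>

lemma fps_compose_mult_nth:
  fixes a b c :: "'a::comm_ring_1 fps"
  assumes "b $ 0 = 0"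
  shows "((a oo b) * c) $ n = (\<Sum>i = 0..n. a $ i * (b ^ i * c) $ n)"
proof -
  have "((a oo b) * c) $ n = (\<Sum>j = 0..n. (\<Sum>i = 0..j. a $ i * (b ^ i) $ j) * c $ (n - j))"
    by (simp add: fps_mult_nth fps_compose_nth)
  also have "\<dots> = (\<Sum>j = 0..n. (\<Sum>i = 0..n. a $ i * (b ^ i) $ j) * c $ (n - j))"
  proof (rule sum.cong[OF refl])
    fix j assume "j \<in> {0..n}"
    then have "(\<Sum>i = 0..j. a $ i * (b ^ i) $ j) = (\<Sum>i = 0..n. a $ i * (b ^ i) $ j)"
      using startsby_zero_power_prefix[OF assms] by (intro sum.mono_neutral_left) auto
    then show "(\<Sum>i = 0..j. a $ i * (b ^ i) $ j) * c $ (n - j)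
        = (\<Sum>i = 0..n. a $ i * (b ^ i) $ j) * c $ (n - j)"
      by simp
  qed
  also have "\<dots> = (\<Sum>i = 0..n. \<Sum>j = 0..n. a $ i * (b ^ i) $ j * c $ (n - j))"
    by (simp add: sum_distrib_right) (rule sum.swap)
  also have "\<dots> = (\<Sum>i = 0..n. a $ i * (b ^ i * c) $ n)"
    by (simp add: fps_mult_nth sum_distrib_left mult.assoc)
  finally show ?thesis .
qed

section \<open>Compositional inverses of monic series\<close>

fun compinv_monic :: "'a::comm_ring_1 fps \<Rightarrow> nat \<Rightarrow> 'a" where
  "compinv_monic a 0 = 0"
| "compinv_monic a (Suc n) =
     fps_X $ Suc n - sum (\<lambda>i. compinv_monic a i * (a ^ i) $ Suc n) {0..n}"

text \<open>In coefficient \<open>Suc n\<close> of \<open>h oo a\<close> the unknown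
  \<open>h $ Suc n\<close> is multiplied by \<open>(a $ 1) ^ Suc n = 1\<close>, so
  \<open>compinv_monic\<close> solves for it without division.\<close>

lemma fps_left_comp_inverse_exists:
  fixes a :: "'a::comm_ring_1 fps"
  assumes "a $ 0 = 0" "a $ 1 = 1"
  shows "\<exists>h. h $ 0 = 0 \<and> h $ 1 = 1 \<and> h oo a = fps_X"
proof (intro exI conjI)
  let ?h = "Abs_fps (compinv_monic a)"
  show "?h $ 0 = 0" "?h $ 1 = 1"
    by simp_all
  show "?h oo a = fps_X"
  proof (rule fps_ext)
    fix n show "(?h oo a) $ n = fps_X $ n"
      using assms by (cases n)
        (simp_all add: fps_compose_nth startsby_zero_power_nth_same[OF assms(1)] del: power_Suc)
  qed
qed

text \<open>The left inverse \<open>h\<close> is again monic and has a left inverse \<open>k\<close>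
  of its own. Associativity of composition forces \<open>k = a\<close>, so \<open>h\<close> is
  two-sided.\<close>

lemma fps_comp_inverse_exists:
  fixes a :: "'a::idom fps"
  assumes "a $ 0 = 0" "a $ 1 = 1"
  shows "\<exists>h. h $ 0 = 0 \<and> a oo h = fps_X \<and> h oo a = fps_X"
proof -
  obtain h where h: "h $ 0 = 0" "h $ 1 = 1" "h oo a = fps_X"
    using fps_left_comp_inverse_exists[OF assms] by blast
  obtain k where k: "k $ 0 = 0" "k oo h = fps_X"
    using fps_left_comp_inverse_exists[OF h(1,2)] by blast
  have "k = k oo (h oo a)"
    using h by simp
  also have "\<dots> = (k oo h) oo a"
    by (rule fps_compose_assoc) fact+
  also have "\<dots> = a"
    unfolding k(2) using assms by (auto simp: fps_X_fps_compose intro: fps_ext)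
  finally show ?thesis
    using h k by blast
qed

lemma fps_comp_inv:
  fixes a :: "'a::idom fps"
  assumes "a $ 0 = 0" "a $ 1 = 1"
  shows "fps_comp_inv a $ 0 = 0" "a oo fps_comp_inv a = fps_X" "fps_comp_inv a oo a = fps_X"
proof -
  have "\<exists>!h. h $ 0 = 0 \<and> a oo h = fps_X \<and> h oo a = fps_X"
    using fps_comp_inverse_exists[OF assms] fps_compose_inj_right[of a] assms
    by (metis one_neq_zero)
  from theI'[OF this] show "fps_comp_inv a $ 0 = 0" "a oo fps_comp_inv a = fps_X"
      "fps_comp_inv a oo a = fps_X"
    unfolding fps_comp_inv_def by blast+
qed

lemma fps_comp_inv_cancel:
  fixes a b :: "'a::idom fps"
  assumes "a $ 0 = 0" "a $ 1 = 1"
  shows "(b oo fps_comp_inv a) oo a = b"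
  using fps_compose_assoc[OF assms(1) fps_comp_inv(1)[OF assms], of b] fps_comp_inv[OF assms]
  by simp

section \<open>Reciprocals and integer powers\<close>

lemma fps_right_inverse_unique:
  fixes a b :: "'a::comm_ring_1 fps"
  assumes "a * b = 1" "a $ 0 = 1"
  shows "fps_right_inverse a 1 = b"
proof -
  have "a * fps_right_inverse a 1 = 1"
    using assms by (intro fps_right_inverse) simp
  then have "b * (a * fps_right_inverse a 1) = b"
    by simp
  then show ?thesis
    using assms by (simp add: mult.assoc[symmetric] mult.commute[of b])
qed

lemma fps_zpow_uminus:
  fixes a b :: "'a::comm_ring_1 fps"
  assumes "a * b = 1" "a $ 0 = 1"
  shows "fps_zpow a (- m) = fps_zpow b m"
proof -
  have "b $ 0 = 1"
    using arg_cong[OF assms(1), of "\<lambda>f. f $ 0"] assms(2) by simp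
  then have "fps_right_inverse b 1 = a" "fps_right_inverse a 1 = b"
    using assms by (auto intro!: fps_right_inverse_unique simp: mult.commute)
  then show ?thesis
    by (simp add: fps_zpow_def)
qed

lemma fps_zpow_compose:
  fixes a b :: "'a::idom fps"
  assumes "a $ 0 = 1" "b $ 0 = 0"
  shows "fps_zpow (a oo b) m = fps_zpow a m oo b"
proof -
  have "(a oo b) * (fps_right_inverse a 1 oo b) = 1"
    using assms fps_right_inverse[of a 1]
    by (simp add: fps_compose_mult_distrib[OF assms(2), symmetric])
  then have "fps_right_inverse (a oo b) 1 = fps_right_inverse a 1 oo b"
    using assms by (intro fps_right_inverse_unique) auto
  then show ?thesis
    using assms by (simp add: fps_zpow_def fps_compose_power)
qed

text \<open>The bound on \<open>m\<close> keeps \<open>int k - m\<close> nonnegative, so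
  \<open>nat\<close> does not truncate. For negative \<open>m\<close> the \<open>nat (- m)\<close>
  surplus factors \<open>a\<close> cancel against the reciprocal.\<close>

lemma fps_zpow_mult_power:
  fixes a :: "'a::comm_ring_1 fps"
  assumes "a $ 0 = 1" "m \<le> int k"
  shows "fps_zpow a m * a ^ nat (int k - m) = a ^ k"
proof (cases "m \<ge> 0")
  case True
  then show ?thesis
    using assms by (simp add: fps_zpow_def power_add[symmetric] nat_add_distrib[symmetric])
next
  case False
  have "nat (int k - m) = nat (- m) + k"
    using False by simp
  moreover have "fps_right_inverse a 1 * a = 1"
    using fps_right_inverse[of a 1] assms by (simp add: mult.commute)
  ultimately show ?thesis
    using False
    by (simp add: fps_zpow_def power_add mult.assoc[symmetric] power_mult_distrib[symmetric])
qed

section \<open>Lagrange inversion\<close>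

lemma fps_mult_inverse_deriv:
  fixes r s :: "'a::comm_ring_1 fps"
  assumes "r * s = 1"
  shows "r * fps_deriv s = - (s * fps_deriv r)"
  using arg_cong[OF assms, of fps_deriv] by (simp add: algebra_simps add_eq_0_iff)

text \<open>With \<open>\<phi> = t s\<close>, this is the residue of the Laurent series \<open>\<phi>\<^sup>j\<^sup>-\<^sup>n\<^sup>-\<^sup>1 \<phi>'\<close>, freed of negative powers of \<open>t\<close>.\<close>

lemma residue_monic_series:
  fixes r s :: "'a::{idom,ring_char_0} fps"
  assumes "r * s = 1" "r $ 0 = 1"
  shows "((fps_X * s) ^ j * (fps_deriv (fps_X * s) * r ^ Suc n)) $ n = (if j = n then 1 else 0)"
proof (cases "j \<le> n")
  case False
  then show ?thesis
    by (simp add: power_mult_distrib mult.assoc fps_X_power_mult_nth)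
next
  case True
  define p where "p = n - j"
  have n: "n = p + j"
    using True by (simp add: p_def)
  have sr: "s ^ j * r ^ j = 1"
    using assms(1) by (simp add: power_mult_distrib[symmetric] mult.commute)
  have "(fps_X * s) ^ j * (fps_deriv (fps_X * s) * r ^ Suc n)
      = fps_X ^ j * ((s ^ j * r ^ j) * (r ^ p * (r * s + fps_X * (r * fps_deriv s))))"
    by (simp add: n power_mult_distrib power_add algebra_simps)
  also have "\<dots> = fps_X ^ j * (r ^ p * (1 - fps_X * (s * fps_deriv r)))"
    using assms by (simp add: sr fps_mult_inverse_deriv[OF assms(1)])
  finally have *: "((fps_X * s) ^ j * (fps_deriv (fps_X * s) * r ^ Suc n)) $ n
      = (r ^ p * (1 - fps_X * (s * fps_deriv r))) $ p"
    by (simp add: n fps_X_power_mult_nth)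
  show ?thesis
  proof (cases p)
    case 0
    then show ?thesis
      using * n by simp
  next
    case (Suc q)
    have "r ^ p * (1 - fps_X * (s * fps_deriv r))
        = r ^ p - fps_X * ((r * s) * (fps_deriv r * r ^ q))"
      by (simp add: Suc algebra_simps)
    also have "\<dots> = r ^ p - fps_X * (fps_deriv r * r ^ q)"
      using assms by simp
    finally have "(r ^ p * (1 - fps_X * (s * fps_deriv r))) $ p
        = (r ^ p) $ p - (fps_deriv r * r ^ q) $ q"
      by (simp add: Suc)
    \<comment> \<open>Coefficient \<open>q\<close> of the derivative of \<open>r ^ p\<close> is also
      \<open>of_nat p * (r ^ p) $ p\<close>. The difference therefore vanishes after multiplication
      by \<open>p\<close>, and the nonzero \<open>p\<close> cancels in characteristic 0.\<close>
    moreover have "fps_deriv (r ^ p) $ q = of_nat p * (fps_deriv r * r ^ q) $ q"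
      by (simp only: fps_deriv_power Suc diff_Suc_1 mult.assoc fps_mult_left_const_nth)
    ultimately have "of_nat p * (r ^ p * (1 - fps_X * (s * fps_deriv r))) $ p
        = of_nat p * (r ^ p) $ p - fps_deriv (r ^ p) $ q"
      by (simp only: right_diff_distrib)
    also have "\<dots> = 0"
      by (simp only: Suc fps_deriv_nth Suc_eq_plus1 diff_self)
    finally have "(r ^ p * (1 - fps_X * (s * fps_deriv r))) $ p = 0"
      using Suc by (simp only: mult_eq_0_iff of_nat_eq_0_iff) simp
    then show ?thesis
      unfolding * using n Suc by simp
  qed
qed

text \<open>Write \<open>H\<close> as \<open>B\<close> composed with \<open>fps_X * s\<close> and
  differentiate. The residue formula then isolates coefficient \<open>n\<close> of the derivative of
  \<open>B\<close>, which is \<open>Suc n\<close> times \<open>B $ Suc n\<close>.\<close>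

lemma lagrange_inversion_monic:
  fixes r s H :: "'a::{idom,ring_char_0} fps"
  assumes "r * s = 1" "r $ 0 = 1"
  shows "of_nat (Suc n) * (H oo fps_comp_inv (fps_X * s)) $ Suc n = (fps_deriv H * r ^ Suc n) $ n"
proof -
  define B where "B = H oo fps_comp_inv (fps_X * s)"
  have "s $ 0 = 1"
    using arg_cong[OF assms(1), of "\<lambda>f. f $ 0"] assms(2) by simp
  then have phi: "(fps_X * s) $ 0 = 0" "(fps_X * s) $ 1 = 1"
    by simp_all
  have "H = B oo (fps_X * s)"
    unfolding B_def using fps_comp_inv_cancel[OF phi] by simp
  then have "fps_deriv H = (fps_deriv B oo (fps_X * s)) * fps_deriv (fps_X * s)"
    using fps_compose_deriv[OF phi(1)] by simp
  then have "(fps_deriv H * r ^ Suc n) $ n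
      = ((fps_deriv B oo (fps_X * s)) * (fps_deriv (fps_X * s) * r ^ Suc n)) $ n"
    by (simp only: mult.assoc)
  also have "\<dots> = (\<Sum>j = 0..n. fps_deriv B $ j * (if j = n then 1 else 0))"
    unfolding fps_compose_mult_nth[OF phi(1)] residue_monic_series[OF assms] ..
  also have "\<dots> = of_nat (Suc n) * B $ Suc n"
    by (simp add: mult_delta_right)
  finally show ?thesis
    by (simp add: B_def)
qed

subsection \<open>Moments of sums of uncorrelated umbrae\<close>

context saturated_umbral_calculus
begin

lemma E_cst: "E (cst r) = r"
  using E_scale[of r 1] E_one by simp

lemma E_cst_right: "E (p * cst r) = r * E p"
  using E_scale[of r p] by (simp add: mult.commute)

lemma E_zero: "E 0 = 0"
  using E_add[of 0 0] by simp

lemma E_sum: "E (sum p I) = (\<Sum>i\<in>I. E (p i))"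
  by (induction I rule: infinite_finite_induct) (simp_all add: E_zero E_add)

lemma E_of_nat_mult: "E (of_nat j * p) = of_nat j * E p"
  by (induction j) (simp_all add: E_zero E_add algebra_simps)

lemma E_powers_uncorrelated:
  assumes "\<gamma> \<noteq> \<delta>"
  shows "E (umb \<gamma> ^ i * umb \<delta> ^ j) = E (umb \<gamma> ^ i) * E (umb \<delta> ^ j)"
  using E_uncorrelated[of "{\<gamma>, \<delta>}" "\<lambda>x. if x = \<gamma> then i else j"] assms by auto

lemma gen_fun_nth_0: "gen_fun E \<beta> $ 0 = 1"
  by (simp add: gen_fun_def E_one)

lemma E_umb_power: "E (umb \<beta> ^ i) = smult (fact i) (gen_fun E \<beta> $ i)"
  by (simp add: gen_fun_def)

lemma is_dot_iff: "is_dot E x \<beta> \<delta> \<longleftrightarrow> gen_fun E \<delta> = fps_zpow (gen_fun E \<beta>) x"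
proof -
  have "E (umb \<delta> ^ i) = smult (fact i) (fps_zpow (gen_fun E \<beta>) x $ i)
      \<longleftrightarrow> gen_fun E \<delta> $ i = fps_zpow (gen_fun E \<beta>) x $ i" for i
    by (auto simp: E_umb_power dest: arg_cong[of _ _ "smult (1 / fact i)"])
  then show ?thesis
    by (simp add: is_dot_def umbral_equiv_def E_cst fps_eq_iff)
qed

lemma fps_zpow_gen_fun_nth_0: "fps_zpow (gen_fun E \<beta>) x $ 0 = 1"
  by (simp add: fps_zpow_def fps_power_zeroth gen_fun_nth_0)

text \<open>Saturation gives infinitely many umbrae with the required moments, so one remains after
  excluding \<beta> and the choice operator has a witness.\<close>

lemma dot_uncorr:
  shows dot_uncorr_neq: "dot_uncorr E \<beta> x \<alpha> \<noteq> \<beta>"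
    and gen_fun_dot_uncorr: "gen_fun E (dot_uncorr E \<beta> x \<alpha>) = fps_zpow (gen_fun E \<alpha>) x"
proof -
  let ?a = "\<lambda>i. smult (fact i) (fps_zpow (gen_fun E \<alpha>) x $ i)"
  have "infinite {\<delta>. \<forall>i. E (umb \<delta> ^ i) = ?a i}"
    by (rule saturated) (simp add: fps_zpow_gen_fun_nth_0)
  then have "infinite ({\<delta>. \<forall>i. E (umb \<delta> ^ i) = ?a i} - {\<beta>})"
    by simp
  then obtain \<delta> where "\<delta> \<noteq> \<beta>" "\<forall>i. E (umb \<delta> ^ i) = ?a i"
    using infinite_imp_nonempty by blast
  then have "\<exists>\<delta>. \<delta> \<noteq> \<beta> \<and> is_dot E x \<alpha> \<delta>"
    by (auto simp: is_dot_def umbral_equiv_def E_cst)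
  from someI_ex[OF this] show "dot_uncorr E \<beta> x \<alpha> \<noteq> \<beta>"
      "gen_fun E (dot_uncorr E \<beta> x \<alpha>) = fps_zpow (gen_fun E \<alpha>) x"
    by (simp_all add: dot_uncorr_def is_dot_iff)
qed

text \<open>Binomial expansion turns into a product of exponential generating functions. The
  exponent \<open>p\<close> serves two cases: \<open>p = 0\<close> for Riordan entries and
  \<open>p = 1\<close> for moments of K, where the shifted series is a derivative.\<close>

lemma E_power_mult_sum_power:
  assumes "\<gamma> \<noteq> \<delta>"
  shows "E (umb \<gamma> ^ p * (umb \<gamma> + umb \<delta>) ^ N)
    = smult (fact N) ((Abs_fps (\<lambda>i. smult (1 / fact i) (E (umb \<gamma> ^ (p + i)))) * gen_fun E \<delta>) $ N)"
proof -
  have smult_fact: "smult (fact N) q = [:fact N:] * q" for q :: "complex poly"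
    by simp
  have "umb \<gamma> ^ p * (umb \<gamma> + umb \<delta>) ^ N
      = (\<Sum>i\<le>N. of_nat (N choose i) * (umb \<gamma> ^ (p + i) * umb \<delta> ^ (N - i)))"
    by (subst binomial_ring) (simp add: sum_distrib_left power_add mult_ac)
  then have "E (umb \<gamma> ^ p * (umb \<gamma> + umb \<delta>) ^ N)
      = (\<Sum>i\<le>N. of_nat (N choose i) * (E (umb \<gamma> ^ (p + i)) * E (umb \<delta> ^ (N - i))))"
    by (simp add: E_sum E_of_nat_mult E_powers_uncorrelated[OF assms])
  also have "\<dots> = (\<Sum>i\<le>N. smult (fact N) (smult (1 / fact i) (E (umb \<gamma> ^ (p + i)))
                          * smult (1 / fact (N - i)) (E (umb \<delta> ^ (N - i)))))"
  proof (rule sum.cong[OF refl])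
    fix i assume "i \<in> {..N}"
    then have "of_nat (N choose i) = [:fact N * (1 / fact i * (1 / fact (N - i))):: complex:]"
      by (simp add: binomial_fact of_nat_poly)
    then show "of_nat (N choose i) * (E (umb \<gamma> ^ (p + i)) * E (umb \<delta> ^ (N - i)))
        = smult (fact N) (smult (1 / fact i) (E (umb \<gamma> ^ (p + i)))
            * smult (1 / fact (N - i)) (E (umb \<delta> ^ (N - i))))"
      by (simp add: mult.commute)
  qed
  also have "\<dots> = smult (fact N)
      ((Abs_fps (\<lambda>i. smult (1 / fact i) (E (umb \<gamma> ^ (p + i)))) * gen_fun E \<delta>) $ N)"
    by (simp only: fps_mult_nth gen_fun_def fps_nth_Abs_fps smult_fact sum_distrib_left
        atLeast0AtMost)
  finally show ?thesis .
qed

lemma E_sum_power: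
  assumes "\<gamma> \<noteq> \<delta>"
  shows "E ((umb \<gamma> + umb \<delta>) ^ N) = smult (fact N) ((gen_fun E \<gamma> * gen_fun E \<delta>) $ N)"
  using E_power_mult_sum_power[OF assms, of 0 N] by (simp add: gen_fun_def)

lemma fps_deriv_gen_fun:
  "fps_deriv (gen_fun E \<gamma>) = Abs_fps (\<lambda>i. smult (1 / fact i) (E (umb \<gamma> ^ Suc i)))"
proof (rule fps_ext)
  fix i
  have "of_nat (Suc i) * smult (1 / fact (Suc i)) q = smult (1 / fact i) q" for q :: "complex poly"
    by (simp add: of_nat_poly divide_simps del: of_nat_Suc)
  then show "fps_deriv (gen_fun E \<gamma>) $ i = Abs_fps (\<lambda>i. smult (1 / fact i) (E (umb \<gamma> ^ Suc i))) $ i"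
    by (simp add: gen_fun_def del: of_nat_Suc power_Suc fact_Suc)
qed

lemma E_mult_sum_power:
  assumes "\<gamma> \<noteq> \<delta>"
  shows "E (umb \<gamma> * (umb \<gamma> + umb \<delta>) ^ N)
    = smult (fact N) ((fps_deriv (gen_fun E \<gamma>) * gen_fun E \<delta>) $ N)"
  using E_power_mult_sum_power[OF assms, of 1 N] by (simp add: fps_deriv_gen_fun)

section \<open>Riordan entries and the K umbra as coefficients\<close>

lemma riordan_eq:
  assumes "k \<le> n"
  shows "riordan E c \<gamma> \<alpha> n k
    = smult (c n / c k) ((gen_fun E \<gamma> * gen_fun E \<alpha> ^ k) $ (n - k))"
  using assms dot_uncorr_neq[of \<gamma> "int k" \<alpha>]
  by (simp add: riordan_def E_scale E_cst_right E_sum_power gen_fun_dot_uncorr fps_zpow_def)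

text \<open>Lagrange inversion with \<open>H\<close> and \<open>s\<close> both taken to be the
  generating function of \<sigma>. Its factor \<open>Suc n\<close> turns the \<open>fact n\<close>
  of the moment formula into \<open>fact (Suc n)\<close>.\<close>

lemma gen_fun_K_umbra:
  assumes "is_K_umbra E \<sigma> \<sigma> K" "f * gen_fun E \<sigma> = 1"
  shows "gen_fun E K = gen_fun E \<sigma> oo fps_comp_inv (fps_X * gen_fun E \<sigma>)"
proof (rule fps_ext)
  let ?s = "gen_fun E \<sigma>"
  fix i show "gen_fun E K $ i = (?s oo fps_comp_inv (fps_X * ?s)) $ i"
  proof (cases i)
    case 0
    then show ?thesis by (simp add: gen_fun_nth_0)
  next
    case (Suc n)
    have f0: "f $ 0 = 1"
      using arg_cong[OF assms(2), of "\<lambda>f. f $ 0"] by (simp add: gen_fun_nth_0)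
    have "fps_zpow ?s (- int (Suc n)) = f ^ Suc n"
      using assms(2) fps_zpow_uminus[of ?s f "int (Suc n)"] gen_fun_nth_0
      by (simp add: fps_zpow_def mult.commute nat_add_distrib del: of_nat_Suc power_Suc)
    then have "E (umb K ^ Suc n) = smult (fact n) ((fps_deriv ?s * f ^ Suc n) $ n)"
      using assms(1) E_mult_sum_power[OF dot_uncorr_neq[symmetric]]
      by (simp add: is_K_umbra_def umbral_equiv_def gen_fun_dot_uncorr del: of_nat_Suc power_Suc)
    also have "\<dots> = smult (fact n)
        (of_nat (Suc n) * (?s oo fps_comp_inv (fps_X * ?s)) $ Suc n)"
      using lagrange_inversion_monic[OF assms(2) f0] by simp
    finally show ?thesis
      by (simp add: Suc gen_fun_def of_nat_poly divide_simps del: of_nat_Suc power_Suc)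
  qed
qed

end

theorem theorem3p19:
  fixes E :: "'u umbral_poly \<Rightarrow> complex poly"
    and c :: "nat \<Rightarrow> complex"
    and \<omega> \<gamma> \<alpha> \<sigma> K \<kappa> :: 'u
    and n k :: nat and m :: int
  assumes "saturated_umbral_calculus E"
    and "\<And>j. c j \<noteq> 0" and "c 0 = 1"
    and "\<And>j. umb \<omega> ^ j \<simeq>\<^bsub>E\<^esub> num (fact j / c j)"
    and "k \<le> n" and "2 * int k - int n \<ge> m"
    and "is_dot E (- 1) \<alpha> \<sigma>"
    and "is_K_umbra E \<sigma> \<sigma> K"
    and "is_dot E (- m) K \<kappa>"
  shows "cst (riordan E c \<gamma> \<alpha> n k) \<simeq>\<^bsub>E\<^esub>
           num (c n / c k) *
           (\<Sum>i = 0..n - k.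
              num (c (nat (int k - m - int i)) / c (nat (int n - m - 2 * int i))) *
              (umb \<kappa> ^ i * num (1 / fact i)) *
              cst (riordan E c \<gamma> \<alpha> (nat (int n - m - 2 * int i)) (nat (int k - m - int i))))
       \<and> (\<forall>i. umb \<kappa> ^ i \<simeq>\<^bsub>E\<^esub>
           cst (smult (fact i)
             (fps_nth
               (fps_zpow
                 (gen_fun E \<alpha> oo fps_comp_inv (fps_X * fps_zpow (gen_fun E \<alpha>) (- 1)))
                 m)
               i)))"
proof -
  interpret saturated_umbral_calculus E by fact
  define f where "f = gen_fun E \<alpha>"
  define s where "s = fps_right_inverse f 1"
  define B where "B = fps_zpow (f oo fps_comp_inv (fps_X * s)) m"
  have f0: "f $ 0 = 1" and s0: "s $ 0 = 1"
    by (simp_all add: f_def s_def gen_fun_nth_0)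
  have fs: "f * s = 1"
    using f0 by (simp add: s_def fps_right_inverse)
  have phi: "(fps_X * s) $ 0 = 0" "(fps_X * s) $ 1 = 1"
    using s0 by simp_all
  have zpow_s: "fps_zpow f (- 1) = s"
    by (simp add: fps_zpow_def s_def)
  have "gen_fun E \<sigma> = s"
    using assms(7) zpow_s by (simp add: is_dot_iff f_def)
  then have "gen_fun E K = s oo fps_comp_inv (fps_X * s)"
    using gen_fun_K_umbra[OF assms(8), of f] fs by simp
  moreover have "(s oo fps_comp_inv (fps_X * s)) * (f oo fps_comp_inv (fps_X * s)) = 1"
    using fs by (simp add: fps_compose_mult_distrib[OF fps_comp_inv(1)[OF phi], symmetric]
        mult.commute)
  \<comment> \<open>The power \<open>- m\<close> of the series of \<open>K\<close> is the power
    \<open>m\<close> of its reciprocal.\<close>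
  ultimately have kappa: "gen_fun E \<kappa> = B"
    using assms(9) s0 by (simp add: is_dot_iff B_def fps_zpow_uminus)
  have B_phi: "B oo (fps_X * s) = fps_zpow f m"
    using fps_zpow_compose[OF f0 fps_comp_inv(1)[OF phi]] fps_comp_inv_cancel[OF phi]
    by (simp add: B_def)
  have term_eq: "E (num (c (nat (int k - m - int i)) / c (nat (int n - m - 2 * int i))) *
              (umb \<kappa> ^ i * num (1 / fact i)) *
              cst (riordan E c \<gamma> \<alpha> (nat (int n - m - 2 * int i)) (nat (int k - m - int i))))
      = B $ i * ((fps_X * s) ^ i * (gen_fun E \<gamma> * f ^ nat (int k - m))) $ (n - k)"
    if "i \<in> {0..n - k}" for i
  proof -
    define k' n' where "k' = nat (int k - m - int i)" and "n' = nat (int n - m - 2 * int i)"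
    have i: "i \<le> n - k"
      using that by simp
    \<comment> \<open>From \<open>2 * int k - int n \<ge> m\<close> follows
      \<open>int k - m \<ge> int (n - k) \<ge> int i\<close>, so neither \<open>nat\<close>
      truncates.\<close>
    have *: "k' \<le> n'" "n' - k' = n - k - i" "nat (int k - m) = i + k'"
      using i assms(5,6) unfolding k'_def n'_def by linarith+
    \<comment> \<open>The \<open>i\<close> factors \<open>s\<close> cancel \<open>i\<close> of the
      factors \<open>f\<close>, leaving the series behind the entry in row \<open>n'\<close>, column
      \<open>k'\<close>.\<close>
    have "(fps_X * s) ^ i * (gen_fun E \<gamma> * f ^ (i + k'))
        = fps_X ^ i * ((f * s) ^ i * (gen_fun E \<gamma> * f ^ k'))"
      by (simp add: power_mult_distrib power_add algebra_simps)
    also have "\<dots> $ (n - k) = (gen_fun E \<gamma> * f ^ k') $ (n - k - i)"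
      using i fs by (simp add: fps_X_power_mult_nth)
    finally have "((fps_X * s) ^ i * (gen_fun E \<gamma> * f ^ (i + k'))) $ (n - k)
        = (gen_fun E \<gamma> * f ^ k') $ (n - k - i)" .
    \<comment> \<open>The quotient of \<open>c\<close> values undoes the normalisation inside
      \<open>riordan\<close>, because all \<open>c j\<close> are nonzero.\<close>
    moreover have "E (num (c k' / c n') * (umb \<kappa> ^ i * num (1 / fact i)) *
        cst (riordan E c \<gamma> \<alpha> n' k')) = B $ i * (gen_fun E \<gamma> * f ^ k') $ (n - k - i)"
      using assms(2) *
      by (simp add: E_scale E_cst_right E_umb_power kappa riordan_eq f_def mult.commute)
    ultimately show ?thesis
      using * by (simp add: k'_def n'_def)
  qed
  \<comment> \<open>Read backwards, the composition lemma collects the sum into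
    \<open>B oo (fps_X * s)\<close>, that is, \<open>fps_zpow f m\<close>, which restores the full
    power \<open>f ^ k\<close>.\<close>
  have "(\<Sum>i = 0..n - k. B $ i * ((fps_X * s) ^ i * (gen_fun E \<gamma> * f ^ nat (int k - m))) $ (n - k))
      = (fps_zpow f m * (gen_fun E \<gamma> * f ^ nat (int k - m))) $ (n - k)"
    unfolding fps_compose_mult_nth[OF phi(1), symmetric] B_phi ..
  also have "\<dots> = (gen_fun E \<gamma> * f ^ k) $ (n - k)"
    using fps_zpow_mult_power[OF f0, of m k] assms(5,6)
    by (simp add: mult.left_commute[of "fps_zpow f m"])
  finally have sum_eq: "(\<Sum>i = 0..n - k. E (num (c (nat (int k - m - int i)) /
                c (nat (int n - m - 2 * int i))) * (umb \<kappa> ^ i * num (1 / fact i)) *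
              cst (riordan E c \<gamma> \<alpha> (nat (int n - m - 2 * int i)) (nat (int k - m - int i)))))
      = (gen_fun E \<gamma> * f ^ k) $ (n - k)"
    using term_eq by simp
  show ?thesis
    unfolding umbral_equiv_def E_scale E_sum sum_eq E_cst
    using assms(5) by (simp add: riordan_eq f_def[symmetric] zpow_s kappa E_umb_power B_def)
qed

end
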